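(* Let $\mathcal{A}$ be an Artin group of (finite) crystallographic type with associated Coxeter group $\mathcal{C}$, root system $\Phi$ and simple roots $\Delta\subset\Phi$. There is a unique group homomorphism $\mathcal{A}\to\mathbb{Z}^{\Phi}\rtimes\mathcal{C}$ such that $a\mapsto(\alpha_a,\mathcal{C}(a))$ for every canonical Artin generator $a$ of $\mathcal{A}$, where $\mathcal{C}(a)$ is the image of $a$ under the quotient map $\mathcal{A}\to\mathcal{C}$ and $\alpha_a\in\mathbb{Z}^\Phi$ is the standard basis vector indexed by the simple root $\Delta_a$.
   Context: Let $\Phi$ be a finite (reduced) crystallographic root system in a Euclidean space, with a choice of simple roots $\Delta\subset\Phi$. Its Weyl group $\mathcal{C}$ is generated by the reflections in the simple roots, and is a Coxeter group with these simple reflections as Coxeter generators. The associated Artin group $\mathcal{A}$ (called an Artin group of crystallographic type) is the group with one canonical generator $a$ for each simple root, denoted $\Delta_a$, and for each pair of distinct generators $a_1,a_2$ the braid relation $a_1a_2a_1\cdots=a_2a_1a_2\cdots$ with $m$ factors on each side, where $m$ is the order in $\mathcal{C}$ of the product of the corresponding simple reflections. The quotient map $\mathcal{A}\to\mathcal{C}$ sends $a$ to the reflection in the hyperplane orthogonal to $\Delta_a$; the image of $x\in\mathcal{A}$ is denoted $\mathcal{C}(x)$. $\mathbb{Z}^\Phi$ is the free abelian group with basis $(e_\phi)_{\phi\in\Phi}$, and $\mathcal{C}$ acts on it by $w\cdot e_\phi=e_{w\phi}$. The group law of $\mathbb{Z}^\Phi\rtimes\mathcal{C}$ is $(v,w)(v',w')=(v+w\cdot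 v',ww')$. *)

theory Defs
  imports
    "HOL-Analysis.Analysis"
    "HOL-Algebra.Bij"
    "HOL-Algebra.Elementary_Groups"
    "HOL-Algebra.Multiplicative_Group"
    "HOL-Algebra.Free_Abelian_Groups"
begin

definition reflection :: "'a::real_inner \<Rightarrow> 'a \<Rightarrow> 'a" where
  "reflection v x = x - (2 * (x \<bullet> v) / (v \<bullet> v)) *\<^sub>R v"

text \<open>
  Finite reduced crystallographic root systems. The roots are not required to span the
  ambient space, so a root system of any rank (including the empty one) in a subspace
  is covered as well.
\<close>
definition root_system :: "'a::euclidean_space set \<Rightarrow> bool" where
  "root_system \<Phi> \<longleftrightarrow>
     finite \<Phi> \<and> 0 \<notin> \<Phi> \<and>
     (\<forall>\<alpha>\<in>\<Phi>. \<forall>\<beta>\<in>\<Phi>. reflection \<alpha> \<beta> \<in> \<Phi>) \<and>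
     (\<forall>\<alpha>\<in>\<Phi>. \<forall>c. c *\<^sub>R \<alpha> \<in> \<Phi> \<longrightarrow> c = 1 \<or> c = -1) \<and>
     (\<forall>\<alpha>\<in>\<Phi>. \<forall>\<beta>\<in>\<Phi>. 2 * (\<beta> \<bullet> \<alpha>) / (\<alpha> \<bullet> \<alpha>) \<in> \<int>)"

definition simple_roots :: "'a::euclidean_space set \<Rightarrow> 'a set \<Rightarrow> bool" where
  "simple_roots \<Phi> \<Delta> \<longleftrightarrow>
     \<Delta> \<subseteq> \<Phi> \<and> independent \<Delta> \<and>
     (\<forall>\<phi>\<in>\<Phi>. \<exists>c :: 'a \<Rightarrow> int.
        \<phi> = (\<Sum>\<delta>\<in>\<Delta>. of_int (c \<delta>) *\<^sub>R \<delta>) \<and>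
        ((\<forall>\<delta>\<in>\<Delta>. c \<delta> \<ge> 0) \<or> (\<forall>\<delta>\<in>\<Delta>. c \<delta> \<le> 0)))"

definition weyl_group :: "'a::euclidean_space set \<Rightarrow> ('a \<Rightarrow> 'a) monoid" where
  "weyl_group \<Delta> = subgroup_generated (BijGroup UNIV) (reflection ` \<Delta>)"

text \<open>
  A letter \<open>(x, True)\<close> stands for the generator \<open>x\<close>, a letter \<open>(x, False)\<close> for its inverse.
\<close>
type_synonym 'b word = "('b \<times> bool) list"

definition words :: "'b set \<Rightarrow> 'b word set" where
  "words X = lists (X \<times> UNIV)"

text \<open>
  The least congruence on the monoid of words over \<open>X\<close> that contains the relations \<open>R\<close>
  and makes the two letters of each generator mutually inverse.
\<close>
inductive_set presentation_rel :: "'b set \<Rightarrow> ('b word \<times> 'b word) set \<Rightarrow> ('b word \<times> 'b word) set"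
  for X R where
  relation: "(u, v) \<in> R \<Longrightarrow> u \<in> words X \<Longrightarrow> v \<in> words X \<Longrightarrow> (u, v) \<in> presentation_rel X R"
| cancel: "x \<in> X \<Longrightarrow> ([(x, s), (x, \<not> s)], []) \<in> presentation_rel X R"
| refl: "u \<in> words X \<Longrightarrow> (u, u) \<in> presentation_rel X R"
| sym: "(u, v) \<in> presentation_rel X R \<Longrightarrow> (v, u) \<in> presentation_rel X R"
| trans: "(u, v) \<in> presentation_rel X R \<Longrightarrow> (v, w) \<in> presentation_rel X R \<Longrightarrow>
    (u, w) \<in> presentation_rel X R"
| append: "(u, v) \<in> presentation_rel X R \<Longrightarrow> (u', v') \<in> presentation_rel X R \<Longrightarrow>
    (u @ u', v @ v') \<in> presentation_rel X R"

definition presented_group :: "'b set \<Rightarrow> ('b word \<times> 'b word) set \<Rightarrow> 'b word set monoid" where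
  "presented_group X R =
     \<lparr>carrier = words X // presentation_rel X R,
      monoid.mult = (\<lambda>A B. \<Union>u\<in>A. \<Union>v\<in>B. presentation_rel X R `` {u @ v}),
      one = presentation_rel X R `` {[]}\<rparr>"

definition presented_gen :: "'b set \<Rightarrow> ('b word \<times> 'b word) set \<Rightarrow> 'b \<Rightarrow> 'b word set" where
  "presented_gen X R x = presentation_rel X R `` {[(x, True)]}"

fun word_eval :: "('g, 'm) monoid_scheme \<Rightarrow> ('b \<Rightarrow> 'g) \<Rightarrow> 'b word \<Rightarrow> 'g" where
  "word_eval G f [] = \<one>\<^bsub>G\<^esub>"
| "word_eval G f ((x, s) # w) = (if s then f x else inv\<^bsub>G\<^esub> f x) \<otimes>\<^bsub>G\<^esub> word_eval G f w"

text \<open>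
  The homomorphism out of a presented group that is induced by \<open>f\<close>; it is meaningful when
  \<open>f\<close> satisfies the relations in \<open>G\<close>, since then \<open>word_eval G f\<close> is constant on each class.
\<close>
definition presented_lift :: "('g, 'm) monoid_scheme \<Rightarrow> ('b \<Rightarrow> 'g) \<Rightarrow> 'b word set \<Rightarrow> 'g" where
  "presented_lift G f A = the_elem (word_eval G f ` A)"

definition alternating_word :: "nat \<Rightarrow> 'b \<Rightarrow> 'b \<Rightarrow> 'b word" where
  "alternating_word m a b = map (\<lambda>i. (if even i then a else b, True)) [0..<m]"

text \<open>The canonical generators are indexed by the simple roots themselves.\<close>

definition braid_relations :: "'a::euclidean_space set \<Rightarrow> ('a word \<times> 'a word) set" where
  "braid_relations \<Delta> =
     {(alternating_word m a b, alternating_word m b a) | m a b.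
        a \<in> \<Delta> \<and> b \<in> \<Delta> \<and> a \<noteq> b \<and>
        m = group.ord (weyl_group \<Delta>) (reflection a \<otimes>\<^bsub>weyl_group \<Delta>\<^esub> reflection b)}"

definition artin_group :: "'a::euclidean_space set \<Rightarrow> 'a word set monoid" where
  "artin_group \<Delta> = presented_group \<Delta> (braid_relations \<Delta>)"

definition artin_gen :: "'a::euclidean_space set \<Rightarrow> 'a \<Rightarrow> 'a word set" where
  "artin_gen \<Delta> = presented_gen \<Delta> (braid_relations \<Delta>)"

definition artin_to_weyl :: "'a::euclidean_space set \<Rightarrow> 'a word set \<Rightarrow> ('a \<Rightarrow> 'a)" where
  "artin_to_weyl \<Delta> = presented_lift (weyl_group \<Delta>) reflection"

definition semidirect_product ::
  "('n, 'k) monoid_scheme \<Rightarrow> ('h, 'm) monoid_scheme \<Rightarrow> ('h \<Rightarrow> 'n \<Rightarrow> 'n) \<Rightarrow> ('n \<times> 'h) monoid" where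
  "semidirect_product N H act =
     \<lparr>carrier = carrier N \<times> carrier H,
      monoid.mult = (\<lambda>(v, w) (v', w'). (v \<otimes>\<^bsub>N\<^esub> act w v', w \<otimes>\<^bsub>H\<^esub> w')),
      one = (\<one>\<^bsub>N\<^esub>, \<one>\<^bsub>H\<^esub>)\<rparr>"

text \<open>The linear extension of \<open>frag_of \<phi> \<mapsto> frag_of (w \<phi>)\<close>.\<close>
definition root_permutation_action :: "('a \<Rightarrow> 'a) \<Rightarrow> ('a \<Rightarrow>\<^sub>0 int) \<Rightarrow> ('a \<Rightarrow>\<^sub>0 int)" where
  "root_permutation_action w = frag_extend (\<lambda>\<phi>. frag_of (w \<phi>))"

definition roots_semidirect_weyl ::
  "'a::euclidean_space set \<Rightarrow> 'a set \<Rightarrow> (('a \<Rightarrow>\<^sub>0 int) \<times> ('a \<Rightarrow> 'a)) monoid" where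
  "roots_semidirect_weyl \<Phi> \<Delta> =
     semidirect_product (free_Abelian_group \<Phi>) (weyl_group \<Delta>) root_permutation_action"

end

theory Submission
  imports Defs
begin

text \<open>
  A homomorphism out of a presented group is determined by its values on the generators, and any
  choice of values that respects the relations extends. So the whole content is that the elements
  \<open>(e\<^sub>a, r\<^sub>a)\<close> of \<open>\<int>\<^sup>\<Phi> \<rtimes> \<C>\<close>, with \<open>r\<^sub>a\<close> the reflection in the simple root \<open>a\<close>, satisfy the
  braid relations.

  Multiplying out the alternating word \<open>a b a \<dots>\<close> of length \<open>m\<close> in the semidirect product gives the
  sum of the basis vectors of the roots
    \<open>a, r\<^sub>a b, r\<^sub>a r\<^sub>b a, \<dots>\<close>
  in the first component (\<open>alternating_word_eval_S\<close>). If \<open>m\<close> is the order of \<open>r\<^sub>a r\<^sub>b\<close>, the word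
  \<open>b a b \<dots>\<close> produces the same list of roots in reverse order (\<open>inversion_root_reverse\<close>). Geometrically
  both lists run through the positive roots in the plane of \<open>a\<close> and \<open>b\<close>, from one side to the other.
  The reflection in the root number \<open>i\<close> (counted from
  \<open>0\<close>) of the first list is \<open>(r\<^sub>a r\<^sub>b)\<^sup>i r\<^sub>a\<close>, and a computation with two involutions shows that it equals
  the reflection in the root number \<open>m - 1 - i\<close> of the second list. A reflection determines a root up to
  sign, so it remains to see that all these roots are positive. The reflection \<open>r\<^sub>a\<close> keeps every
  positive root positive except \<open>a\<close> itself, and meeting \<open>a\<close> along the way would give a relation
  \<open>(r\<^sub>b r\<^sub>a)\<^sup>n = 1\<close> with \<open>0 < n < m\<close> (\<open>inversion_root_nonneg\<close>).
\<close>

section \<open>Groups given by generators and relations\<close>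

lemma words_simps [simp]:
  "[] \<in> words X"
  "(x, s) # w \<in> words X \<longleftrightarrow> x \<in> X \<and> w \<in> words X"
  "u @ v \<in> words X \<longleftrightarrow> u \<in> words X \<and> v \<in> words X"
  by (auto simp: words_def)

lemma presentation_rel_words:
  "(u, v) \<in> presentation_rel X R \<Longrightarrow> u \<in> words X \<and> v \<in> words X"
  by (induction rule: presentation_rel.induct) auto

lemma equiv_presentation_rel: "equiv (words X) (presentation_rel X R)"
proof (rule equivI)
  show "presentation_rel X R \<subseteq> words X \<times> words X"
    using presentation_rel_words by fastforce
  show "refl_on (words X) (presentation_rel X R)"
    by (auto intro!: refl_onI presentation_rel.refl)
  show "sym (presentation_rel X R)" "trans (presentation_rel X R)"
    by (auto intro: symI transI presentation_rel.sym presentation_rel.trans)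
qed

abbreviation word_class :: "'b set \<Rightarrow> ('b word \<times> 'b word) set \<Rightarrow> 'b word \<Rightarrow> 'b word set" where
  "word_class X R w \<equiv> presentation_rel X R `` {w}"

lemma word_class_eq:
  "(u, v) \<in> presentation_rel X R \<Longrightarrow> word_class X R u = word_class X R v"
  using equiv_class_eq[OF equiv_presentation_rel] .

lemma word_class_in_carrier [simp]:
  "w \<in> words X \<Longrightarrow> word_class X R w \<in> carrier (presented_group X R)"
  by (simp add: presented_group_def quotientI)

lemma presented_group_carrierE:
  assumes "A \<in> carrier (presented_group X R)"
  obtains w where "w \<in> words X" "A = word_class X R w"
  using assms by (auto simp: presented_group_def elim: quotientE)

lemma presented_group_mult [simp]:
  assumes "u \<in> words X" "v \<in> words X"
  shows "word_class X R u \<otimes>\<^bsub>presented_group X R\<^esub> word_class X R v = word_class X R (u @ v)"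
proof -
  have "congruent2 (presentation_rel X R) (presentation_rel X R) (\<lambda>u v. word_class X R (u @ v))"
    by (auto simp: congruent2_def intro!: word_class_eq presentation_rel.append)
  from UN_equiv_class2[OF equiv_presentation_rel equiv_presentation_rel this assms]
  show ?thesis by (simp add: presented_group_def)
qed

lemma presented_group_one: "\<one>\<^bsub>presented_group X R\<^esub> = word_class X R []"
  by (simp add: presented_group_def)

text \<open>
  The inverse is the reversed word with all exponents flipped: it is built by appending, to the
  inverse of the rest of the word, the inverse of the first letter.
\<close>
lemma word_left_inverse:
  assumes "w \<in> words X"
  shows "\<exists>v\<in>words X. (v @ w, []) \<in> presentation_rel X R"
  using assms
proof (induction w)
  case Nil
  then show ?case by (auto intro!: bexI[of _ "[]"] presentation_rel.refl)
next
  case (Cons l w)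
  obtain x s where l: "l = (x, s)" by fastforce
  then have x: "x \<in> X" and w: "w \<in> words X" using Cons.prems by auto
  then obtain v where v: "v \<in> words X" "(v @ w, []) \<in> presentation_rel X R"
    using Cons.IH by auto
  have "([(x, \<not> s), (x, s)], []) \<in> presentation_rel X R"
    using presentation_rel.cancel[OF x, of "\<not> s"] by simp
  with v w have "(v @ ([(x, \<not> s), (x, s)] @ w), v @ ([] @ w)) \<in> presentation_rel X R"
    by (intro presentation_rel.append presentation_rel.refl)
  then have "((v @ [(x, \<not> s)]) @ (l # w), []) \<in> presentation_rel X R"
    using v l by (auto intro: presentation_rel.trans)
  then show ?case using v x by (intro bexI[of _ "v @ [(x, \<not> s)]"]) auto
qed

lemma group_presented_group: "group (presented_group X R)"
proof (rule groupI)
  fix A B C assume "A \<in> carrier (presented_group X R)" "B \<in> carrier (presented_group X R)"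
    "C \<in> carrier (presented_group X R)"
  then show "A \<otimes>\<^bsub>presented_group X R\<^esub> B \<otimes>\<^bsub>presented_group X R\<^esub> C =
      A \<otimes>\<^bsub>presented_group X R\<^esub> (B \<otimes>\<^bsub>presented_group X R\<^esub> C)"
    by (auto elim!: presented_group_carrierE)
next
  fix A assume "A \<in> carrier (presented_group X R)"
  then obtain w where w: "w \<in> words X" "A = word_class X R w" by (rule presented_group_carrierE)
  obtain v where "v \<in> words X" "(v @ w, []) \<in> presentation_rel X R"
    using word_left_inverse[OF w(1)] by blast
  with w show "\<exists>B\<in>carrier (presented_group X R).
      B \<otimes>\<^bsub>presented_group X R\<^esub> A = \<one>\<^bsub>presented_group X R\<^esub>"
    by (intro bexI[of _ "word_class X R v"])
      (simp_all add: presented_group_one word_class_eq[of "v @ w"])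
qed (auto elim!: presented_group_carrierE simp: presented_group_one)

lemma (in group) word_eval_closed [simp]:
  "f \<in> X \<rightarrow> carrier G \<Longrightarrow> w \<in> words X \<Longrightarrow> word_eval G f w \<in> carrier G"
  by (induction w) (auto simp: Pi_iff)

lemma (in group) word_eval_append:
  assumes "f \<in> X \<rightarrow> carrier G" "u \<in> words X" "v \<in> words X"
  shows "word_eval G f (u @ v) = word_eval G f u \<otimes> word_eval G f v"
  using assms(2)
proof (induction u)
  case (Cons l u)
  obtain x s where "l = (x, s)" by fastforce
  with Cons assms show ?case by (auto simp: m_assoc Pi_iff)
qed (use assms in simp)

text \<open>
  Equality of values under \<open>word_eval\<close> is itself a congruence that cancels mutually inverse letters,
  and \<open>presentation_rel\<close> is the least such congruence containing \<open>R\<close>. This makes the induced map on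
  classes well defined.
\<close>
lemma (in group) word_eval_presentation_rel:
  assumes f: "f \<in> X \<rightarrow> carrier G"
    and R: "\<forall>(u, v)\<in>R. word_eval G f u = word_eval G f v"
    and uv: "(u, v) \<in> presentation_rel X R"
  shows "word_eval G f u = word_eval G f v"
  using uv
proof (induction rule: presentation_rel.induct)
  case (append u v u' v')
  then show ?case
    using word_eval_append[OF f] presentation_rel_words by metis
next
  case (cancel x s)
  with f have "f x \<in> carrier G" by auto
  then show ?case by auto
qed (use R in auto)

lemma (in group) presented_lift_word_class:
  assumes "f \<in> X \<rightarrow> carrier G"
    and "\<forall>(u, v)\<in>R. word_eval G f u = word_eval G f v"
    and "w \<in> words X"
  shows "presented_lift G f (word_class X R w) = word_eval G f w"
proof -
  have "w \<in> word_class X R w"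
    using assms(3) by (simp add: presentation_rel.refl)
  moreover have "word_eval G f v = word_eval G f w" if "v \<in> word_class X R w" for v
    using that by (intro word_eval_presentation_rel[OF assms(1,2), symmetric]) simp
  ultimately have "word_eval G f ` word_class X R w = {word_eval G f w}"
    by blast
  then show ?thesis by (simp add: presented_lift_def)
qed

lemma (in group) presented_lift_gen:
  assumes "f \<in> X \<rightarrow> carrier G"
    and "\<forall>(u, v)\<in>R. word_eval G f u = word_eval G f v"
    and "x \<in> X"
  shows "presented_lift G f (presented_gen X R x) = f x"
  using presented_lift_word_class[OF assms(1,2), where w = "[(x, True)]"] assms(1,3)
  by (auto simp: presented_gen_def Pi_iff)

lemma (in group) presented_lift_hom:
  assumes "f \<in> X \<rightarrow> carrier G"
    and "\<forall>(u, v)\<in>R. word_eval G f u = word_eval G f v"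
  shows "presented_lift G f \<in> hom (presented_group X R) G"
  using presented_lift_word_class[OF assms] word_eval_append[OF assms(1)]
    word_eval_closed[OF assms(1)]
  by (intro homI) (auto elim!: presented_group_carrierE)

text \<open>
  A class is the product of the classes of its letters, which are generators or their inverses;
  hence a homomorphism is recovered from its values on the generators.
\<close>
lemma presented_group_hom_word_class:
  assumes "group_hom (presented_group X R) G h" and "w \<in> words X"
  shows "h (word_class X R w) = word_eval G (\<lambda>x. h (presented_gen X R x)) w"
  using assms(2)
proof (induction w)
  case Nil
  show ?case
    using group_hom.hom_one[OF assms(1)] by (simp add: presented_group_one)
next
  case (Cons l w)
  interpret h: group_hom "presented_group X R" G h by (rule assms)
  obtain x s where l: "l = (x, s)" by fastforce
  then have x: "x \<in> X" and w: "w \<in> words X" using Cons.prems by auto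
  have inv: "word_class X R [(x, False)] = inv\<^bsub>presented_group X R\<^esub> word_class X R [(x, True)]"
    using x word_class_eq[OF presentation_rel.cancel[OF x, of False]]
    by (intro h.G.inv_equality[symmetric]) (auto simp: presented_group_one)
  have "h (word_class X R (l # w)) = h (word_class X R [(x, s)]) \<otimes>\<^bsub>G\<^esub> h (word_class X R w)"
    using x w l h.hom_mult[of "word_class X R [(x, s)]" "word_class X R w"] by simp
  with Cons.IH[OF w] x l inv show ?case
    by (cases s) (simp_all add: presented_gen_def)
qed

lemma word_eval_cong:
  "(\<And>x. x \<in> X \<Longrightarrow> f x = g x) \<Longrightarrow> w \<in> words X \<Longrightarrow> word_eval G f w = word_eval G g w"
  by (induction w) auto

lemma presented_group_hom_unique:
  assumes "group_hom (presented_group X R) G h" "group_hom (presented_group X R) G k"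
    and "\<And>x. x \<in> X \<Longrightarrow> h (presented_gen X R x) = k (presented_gen X R x)"
    and "A \<in> carrier (presented_group X R)"
  shows "h A = k A"
  using assms(4)
proof (rule presented_group_carrierE)
  fix w assume "w \<in> words X" "A = word_class X R w"
  then show ?thesis
    using assms(1-3) by (auto simp: presented_group_hom_word_class intro: word_eval_cong)
qed

section \<open>Semidirect products\<close>

lemma group_semidirect_product:
  assumes N: "group N" and H: "group H"
    and hom: "\<And>h. h \<in> carrier H \<Longrightarrow> act h \<in> hom N N"
    and one: "\<And>n. n \<in> carrier N \<Longrightarrow> act \<one>\<^bsub>H\<^esub> n = n"
    and mult: "\<And>h h' n. h \<in> carrier H \<Longrightarrow> h' \<in> carrier H \<Longrightarrow> n \<in> carrier N \<Longrightarrow>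
      act (h \<otimes>\<^bsub>H\<^esub> h') n = act h (act h' n)"
  shows "group (semidirect_product N H act)"
proof -
  interpret N: group N by (rule N)
  interpret H: group H by (rule H)
  have closed [simp]: "act h n \<in> carrier N" if "h \<in> carrier H" "n \<in> carrier N" for h n
    using hom that by (auto simp: hom_def)
  have act_mult [simp]: "act h (n \<otimes>\<^bsub>N\<^esub> n') = act h n \<otimes>\<^bsub>N\<^esub> act h n'"
    if "h \<in> carrier H" "n \<in> carrier N" "n' \<in> carrier N" for h n n'
    using hom that by (auto simp: hom_def)
  have act_one [simp]: "act h \<one>\<^bsub>N\<^esub> = \<one>\<^bsub>N\<^esub>" if "h \<in> carrier H" for h
    using hom_one[OF hom[OF that] N N] .
  show ?thesis
  proof (rule groupI)
    fix x assume "x \<in> carrier (semidirect_product N H act)"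
    then obtain n h where x: "x = (n, h)" "n \<in> carrier N" "h \<in> carrier H"
      by (auto simp: semidirect_product_def)
    \<comment> \<open>The inverse of \<open>(n, h) = (n, 1) (0, h)\<close> is \<open>(0, h\<inverse>) (- n, 1)\<close>.\<close>
    let ?y = "(act (inv\<^bsub>H\<^esub> h) (inv\<^bsub>N\<^esub> n), inv\<^bsub>H\<^esub> h)"
    have "act (inv\<^bsub>H\<^esub> h) (inv\<^bsub>N\<^esub> n) \<otimes>\<^bsub>N\<^esub> act (inv\<^bsub>H\<^esub> h) n = \<one>\<^bsub>N\<^esub>"
      using x by (simp flip: act_mult)
    then show "\<exists>y\<in>carrier (semidirect_product N H act).
        y \<otimes>\<^bsub>semidirect_product N H act\<^esub> x = \<one>\<^bsub>semidirect_product N H act\<^esub>"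
      using x by (intro bexI[of _ ?y]) (auto simp: semidirect_product_def)
  qed (auto simp: semidirect_product_def one mult N.m_assoc H.m_assoc)
qed

section \<open>Products of two involutions\<close>

context group
begin

lemma nat_pow_mult_swap:
  assumes "x \<in> carrier G" "y \<in> carrier G"
  shows "(x \<otimes> y) [^] (n::nat) \<otimes> x = x \<otimes> (y \<otimes> x) [^] n"
proof (induction n)
  case (Suc n)
  have "(x \<otimes> y) [^] Suc n \<otimes> x = ((x \<otimes> y) [^] n \<otimes> x) \<otimes> (y \<otimes> x)"
    using assms by (simp add: m_assoc)
  also have "\<dots> = x \<otimes> (y \<otimes> x) [^] Suc n"
    using assms Suc by (simp add: m_assoc)
  finally show ?case .
qed (use assms in simp)

lemma involution_products_inverse:
  assumes "x \<in> carrier G" "y \<in> carrier G" "x \<otimes> x = \<one>" "y \<otimes> y = \<one>"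
  shows "inv (x \<otimes> y) = y \<otimes> x"
  using assms by (simp add: inv_mult_group inv_equality)

lemma involution_products_ord:
  assumes "x \<in> carrier G" "y \<in> carrier G" "x \<otimes> x = \<one>" "y \<otimes> y = \<one>"
  shows "ord (y \<otimes> x) = ord (x \<otimes> y)"
  using assms ord_inv[of "x \<otimes> y"] by (simp add: involution_products_inverse)

text \<open>
  In the dihedral group generated by \<open>x\<close> and \<open>y\<close>, a conjugate of a generator can be written as an
  alternating product of odd length beginning with \<open>x\<close> or as one beginning with \<open>y\<close>. The two lengths,
  \<open>2 i + 1\<close> and \<open>2 j + 1\<close>, add up to twice the exponent that kills \<open>x \<otimes> y\<close>.
\<close>
lemma involution_conjugates_coincide:
  assumes x: "x \<in> carrier G" "x \<otimes> x = \<one>" and y: "y \<in> carrier G" "y \<otimes> y = \<one>"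
    and order: "(x \<otimes> y) [^] Suc (i + j) = \<one>"
  shows "(x \<otimes> y) [^] i \<otimes> x = (y \<otimes> x) [^] j \<otimes> y"
proof -
  have "(x \<otimes> y) [^] i \<otimes> (x \<otimes> y) [^] Suc j = \<one>"
    using order x y nat_pow_mult[of "x \<otimes> y" i "Suc j"] by simp
  then have "(x \<otimes> y) [^] i = inv ((x \<otimes> y) [^] Suc j)"
    using x y by (intro inv_equality[symmetric]) (auto simp del: nat_pow_Suc)
  also have "\<dots> = (y \<otimes> x) [^] Suc j"
    using x y nat_pow_inv[of "x \<otimes> y" "Suc j"] by (simp add: involution_products_inverse)
  finally have "(x \<otimes> y) [^] i \<otimes> x = (y \<otimes> x) [^] j \<otimes> (y \<otimes> (x \<otimes> x))"
    using x y by (simp add: m_assoc)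
  with x y show ?thesis by simp
qed

end

lemma alternating_word_0 [simp]: "alternating_word 0 a b = []"
  by (simp add: alternating_word_def)

lemma alternating_word_Suc [simp]:
  "alternating_word (Suc m) a b = (a, True) # alternating_word m b a"
  by (simp add: alternating_word_def upt_conv_Cons map_Suc_upt[symmetric] del: upt_Suc)

lemma alternating_word_in_words [simp]:
  "a \<in> X \<Longrightarrow> b \<in> X \<Longrightarrow> alternating_word m a b \<in> words X"
  by (induction m arbitrary: a b) auto

text \<open>
  The two alternating products differ by a power of \<open>f a \<otimes> f b\<close> whatever the parity of \<open>m\<close>:
  prolonging both words by a letter in front costs exactly one more factor. When
  \<open>m\<close> is the order of \<open>f a \<otimes> f b\<close>, the power disappears and the braid relation results.
\<close>
lemma (in group) alternating_word_eval_swap: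
  assumes "f a \<in> carrier G" "f a \<otimes> f a = \<one>" "f b \<in> carrier G" "f b \<otimes> f b = \<one>"
  shows "word_eval G f (alternating_word m a b)
    = (f a \<otimes> f b) [^] m \<otimes> word_eval G f (alternating_word m b a)"
  using assms
proof (induction m arbitrary: a b)
  case (Suc m)
  let ?P = "\<lambda>a b. word_eval G f (alternating_word m a b)"
  have closed: "?P a b \<in> carrier G" "?P b a \<in> carrier G"
    using Suc.prems by (auto intro!: word_eval_closed[of _ "{a, b}"])
  have "f a \<otimes> ?P b a = f a \<otimes> ((f b \<otimes> f a) [^] m \<otimes> ?P a b)"
    using Suc.IH[of b a] Suc.prems by simp
  also have "\<dots> = ((f a \<otimes> f b) [^] m \<otimes> f a) \<otimes> ?P a b"
    using Suc.prems closed by (simp add: nat_pow_mult_swap m_assoc)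
  also have "\<dots> = ((f a \<otimes> f b) [^] m \<otimes> (f a \<otimes> (f b \<otimes> f b))) \<otimes> ?P a b"
    using Suc.prems by simp
  also have "\<dots> = (f a \<otimes> f b) [^] Suc m \<otimes> (f b \<otimes> ?P a b)"
    using Suc.prems(1,3) closed by (simp add: m_assoc)
  finally show ?case by simp
qed simp

section \<open>Reflections and simple roots\<close>

lemma linear_reflection: "linear (reflection v)"
  by (rule linearI)
    (auto simp: reflection_def inner_add_left add_divide_distrib algebra_simps)

lemma reflection_self: "v \<noteq> 0 \<Longrightarrow> reflection v v = - v"
  by (simp add: reflection_def scaleR_2)

lemma reflection_involution [simp]: "reflection v (reflection v x) = x"
  by (cases "v = 0") (simp_all add: reflection_def inner_diff_left)

lemma inner_reflection: "reflection v x \<bullet> reflection v y = x \<bullet> y"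
  by (cases "v = 0")
    (simp_all add: reflection_def inner_diff_left inner_diff_right inner_commute field_simps)

text \<open>
  Conjugation by an isometry turns the reflection in \<open>u\<close> into the reflection in the image of \<open>u\<close>.
\<close>
lemma reflection_reflection:
  "reflection (reflection v u) x = reflection v (reflection u (reflection v x))"
proof -
  have "reflection v x \<bullet> u = x \<bullet> reflection v u"
    using inner_reflection[of v "reflection v x" u] by simp
  then show ?thesis
    by (simp add: reflection_def[of u "reflection v x"] reflection_def[of "reflection v u" x]
        inner_reflection linear_diff[OF linear_reflection] linear_scale[OF linear_reflection])
qed

locale root_base =
  fixes \<Phi> \<Delta> :: "'a::euclidean_space set"
  assumes root_system: "root_system \<Phi>" and simple_roots: "simple_roots \<Phi> \<Delta>"
begin

abbreviation W where "W \<equiv> weyl_group \<Delta>"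

text \<open>On roots this predicate is positivity with respect to the base \<open>\<Delta>\<close>.\<close>
definition nonneg_comb :: "'a \<Rightarrow> bool" where
  "nonneg_comb v \<longleftrightarrow> (\<exists>c :: 'a \<Rightarrow> real. (\<forall>\<delta>\<in>\<Delta>. c \<delta> \<ge> 0) \<and> v = (\<Sum>\<delta>\<in>\<Delta>. c \<delta> *\<^sub>R \<delta>))"

lemma simple_root_in_roots: "a \<in> \<Delta> \<Longrightarrow> a \<in> \<Phi>"
  using simple_roots by (auto simp: simple_roots_def)

lemma root_nonzero: "\<phi> \<in> \<Phi> \<Longrightarrow> \<phi> \<noteq> 0"
  using root_system by (auto simp: root_system_def)

lemma reflection_root: "\<alpha> \<in> \<Phi> \<Longrightarrow> \<beta> \<in> \<Phi> \<Longrightarrow> reflection \<alpha> \<beta> \<in> \<Phi>"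
  using root_system by (auto simp: root_system_def)

lemma proportional_roots: "\<alpha> \<in> \<Phi> \<Longrightarrow> c *\<^sub>R \<alpha> \<in> \<Phi> \<Longrightarrow> c = 1 \<or> c = -1"
  using root_system by (auto simp: root_system_def)

lemma independent_base: "independent \<Delta>"
  using simple_roots by (auto simp: simple_roots_def)

lemma finite_base: "finite \<Delta>"
  using independent_base by (rule independent_imp_finite)

lemma base_coefficients_unique:
  assumes "(\<Sum>\<delta>\<in>\<Delta>. c \<delta> *\<^sub>R \<delta>) = (\<Sum>\<delta>\<in>\<Delta>. d \<delta> *\<^sub>R \<delta>)" and "\<delta> \<in> \<Delta>"
  shows "c \<delta> = d \<delta>"
proof -
  have "(\<Sum>\<delta>\<in>\<Delta>. (c \<delta> - d \<delta>) *\<^sub>R \<delta>) = 0"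
    using assms(1) by (simp add: scaleR_diff_left sum_subtractf)
  with independent_base finite_base assms(2) show ?thesis
    using independentD[of \<Delta> \<Delta> "\<lambda>\<delta>. c \<delta> - d \<delta>" \<delta>] by auto
qed

lemma root_sign:
  assumes "\<phi> \<in> \<Phi>"
  obtains "nonneg_comb \<phi>" | "nonneg_comb (- \<phi>)"
proof -
  obtain c :: "'a \<Rightarrow> int" where c: "\<phi> = (\<Sum>\<delta>\<in>\<Delta>. of_int (c \<delta>) *\<^sub>R \<delta>)"
    and s: "(\<forall>\<delta>\<in>\<Delta>. c \<delta> \<ge> 0) \<or> (\<forall>\<delta>\<in>\<Delta>. c \<delta> \<le> 0)"
    using simple_roots assms unfolding simple_roots_def by meson
  from s show ?thesis
  proof
    assume "\<forall>\<delta>\<in>\<Delta>. c \<delta> \<ge> 0"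
    with c have "nonneg_comb \<phi>"
      unfolding nonneg_comb_def by (intro exI[of _ "\<lambda>\<delta>. of_int (c \<delta>)"]) auto
    then show ?thesis by (rule that)
  next
    assume "\<forall>\<delta>\<in>\<Delta>. c \<delta> \<le> 0"
    with c have "nonneg_comb (- \<phi>)"
      unfolding nonneg_comb_def by (intro exI[of _ "\<lambda>\<delta>. - of_int (c \<delta>)"]) (auto simp: sum_negf)
    then show ?thesis by (rule that)
  qed
qed

lemma nonneg_comb_simple: "a \<in> \<Delta> \<Longrightarrow> nonneg_comb a"
  unfolding nonneg_comb_def
  by (intro exI[of _ "\<lambda>\<delta>. if \<delta> = a then 1 else 0"])
    (auto simp: if_distrib[of "\<lambda>c. c *\<^sub>R _"] finite_base cong: if_cong)

lemma nonneg_comb_antisym: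
  assumes "nonneg_comb v" "nonneg_comb (- v)"
  shows "v = 0"
proof -
  obtain c d where c: "\<forall>\<delta>\<in>\<Delta>. c \<delta> \<ge> 0" "v = (\<Sum>\<delta>\<in>\<Delta>. c \<delta> *\<^sub>R \<delta>)"
    and d: "\<forall>\<delta>\<in>\<Delta>. d \<delta> \<ge> 0" "- v = (\<Sum>\<delta>\<in>\<Delta>. d \<delta> *\<^sub>R \<delta>)"
    using assms unfolding nonneg_comb_def by metis
  have "(\<Sum>\<delta>\<in>\<Delta>. c \<delta> *\<^sub>R \<delta>) = (\<Sum>\<delta>\<in>\<Delta>. (- d \<delta>) *\<^sub>R \<delta>)"
    using c(2) d(2) by (simp add: sum_negf) (metis minus_minus)
  then have "c \<delta> = - d \<delta>" if "\<delta> \<in> \<Delta>" for \<delta>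
    by (rule base_coefficients_unique) (rule that)
  with c(1) d(1) have "c \<delta> = 0" if "\<delta> \<in> \<Delta>" for \<delta>
    using that by force
  with c(2) show ?thesis by simp
qed

text \<open>
  The reflection in \<open>a\<close> changes only the coefficient of \<open>a\<close>. If the image is negative, all other
  coefficients of \<open>\<phi>\<close> vanish, and the only positive multiple of \<open>a\<close> in a reduced root system
  is \<open>a\<close>.
\<close>
lemma reflection_preserves_nonneg_comb:
  assumes a: "a \<in> \<Delta>" and \<phi>: "\<phi> \<in> \<Phi>" "nonneg_comb \<phi>" "\<phi> \<noteq> a"
  shows "nonneg_comb (reflection a \<phi>)"
proof (rule ccontr)
  assume neg: "\<not> nonneg_comb (reflection a \<phi>)"
  have "reflection a \<phi> \<in> \<Phi>" using a \<phi> by (simp add: reflection_root simple_root_in_roots)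
  with neg have "nonneg_comb (- reflection a \<phi>)" using root_sign by blast
  then obtain d where d: "\<forall>\<delta>\<in>\<Delta>. d \<delta> \<ge> 0" "- reflection a \<phi> = (\<Sum>\<delta>\<in>\<Delta>. d \<delta> *\<^sub>R \<delta>)"
    unfolding nonneg_comb_def by blast
  obtain c where c: "\<forall>\<delta>\<in>\<Delta>. c \<delta> \<ge> 0" "\<phi> = (\<Sum>\<delta>\<in>\<Delta>. c \<delta> *\<^sub>R \<delta>)"
    using \<phi> unfolding nonneg_comb_def by blast
  \<comment> \<open>The nonnegative coefficients \<open>c\<close> and \<open>d\<close> add up to those of a multiple of \<open>a\<close>.\<close>
  define k where "k = 2 * (\<phi> \<bullet> a) / (a \<bullet> a)"
  have "(\<Sum>\<delta>\<in>\<Delta>. (c \<delta> + d \<delta>) *\<^sub>R \<delta>) = \<phi> + - reflection a \<phi>"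
    using c(2) d(2) by (simp add: scaleR_left_distrib sum.distrib)
  also have "\<dots> = k *\<^sub>R a"
    by (simp add: reflection_def k_def)
  also have "\<dots> = (\<Sum>\<delta>\<in>\<Delta>. (if \<delta> = a then k else 0) *\<^sub>R \<delta>)"
    using a finite_base by (simp add: if_distrib[of "\<lambda>c. c *\<^sub>R _"] cong: if_cong)
  finally have "c \<delta> + d \<delta> = (if \<delta> = a then k else 0)" if "\<delta> \<in> \<Delta>" for \<delta>
    by (rule base_coefficients_unique) (rule that)
  then have "c \<delta> = 0" if "\<delta> \<in> \<Delta>" "\<delta> \<noteq> a" for \<delta>
    using that c(1) d(1) by (smt (verit, best))
  then have "\<phi> = (\<Sum>\<delta>\<in>\<Delta>. if \<delta> = a then c a *\<^sub>R a else 0)"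
    unfolding c(2) by (intro sum.cong) auto
  then have eq: "\<phi> = c a *\<^sub>R a"
    using a finite_base by simp
  then have "c a = 1 \<or> c a = -1"
    using proportional_roots[of a "c a"] a \<phi>(1) simple_root_in_roots by simp
  moreover have "c a \<ge> 0" using c(1) a by blast
  ultimately show False using eq \<phi>(3) by auto
qed

text \<open>
  The vectors that a reflection negates form a line, and a reduced root system meets such a line in
  at most a pair of opposite roots, of which only one is positive.
\<close>
lemma positive_root_determined_by_reflection:
  assumes "u \<in> \<Phi>" "v \<in> \<Phi>" "nonneg_comb u" "nonneg_comb v" "reflection u = reflection v"
  shows "u = v"
proof -
  have "- u = reflection v u"
    using reflection_self[OF root_nonzero[OF assms(1)]] assms(5) by simp
  then have "(2::real) *\<^sub>R u = (2 * (u \<bullet> v) / (v \<bullet> v)) *\<^sub>R v"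
    by (simp add: reflection_def scaleR_2 algebra_simps)
  then have "(1/2::real) *\<^sub>R (2::real) *\<^sub>R u = (1/2::real) *\<^sub>R (2 * (u \<bullet> v) / (v \<bullet> v)) *\<^sub>R v"
    by simp
  then have u: "u = ((u \<bullet> v) / (v \<bullet> v)) *\<^sub>R v"
    by simp
  then have "(u \<bullet> v) / (v \<bullet> v) = 1 \<or> (u \<bullet> v) / (v \<bullet> v) = -1"
    using proportional_roots assms(1,2) by metis
  then show ?thesis
  proof
    assume "(u \<bullet> v) / (v \<bullet> v) = -1"
    with u have "u = - v" by simp
    with nonneg_comb_antisym[of v] assms root_nonzero show ?thesis by auto
  next
    assume "(u \<bullet> v) / (v \<bullet> v) = 1"
    with u show ?thesis by (metis scaleR_one)
  qed
qed

section \<open>The Weyl group and its action on the roots\<close>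

lemma group_W [simp]: "group W"
  unfolding weyl_group_def by (intro group.group_subgroup_generated group_BijGroup)

sublocale W: group W by simp

lemma reflection_in_Bij: "reflection a \<in> Bij UNIV"
  by (auto simp: Bij_def intro: bij_betw_byWitness[where f' = "reflection a"])

lemma reflection_in_W [simp]: "a \<in> \<Delta> \<Longrightarrow> reflection a \<in> carrier W"
  unfolding weyl_group_def carrier_subgroup_generated
  by (rule generate.incl) (auto simp: BijGroup_def reflection_in_Bij)

lemma W_one: "\<one>\<^bsub>W\<^esub> = id"
  by (auto simp: weyl_group_def BijGroup_def)

lemma W_mult:
  assumes "g \<in> carrier W" "h \<in> carrier W"
  shows "g \<otimes>\<^bsub>W\<^esub> h = g \<circ> h"
proof -
  have "carrier W \<subseteq> Bij UNIV"
    using group.carrier_subgroup_generated_subset[OF group_BijGroup, of UNIV]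
    by (simp add: weyl_group_def BijGroup_def)
  with assms show ?thesis
    by (auto simp: weyl_group_def BijGroup_def compose_def)
qed

lemma reflection_squared [simp]: "a \<in> \<Delta> \<Longrightarrow> reflection a \<otimes>\<^bsub>W\<^esub> reflection a = \<one>\<^bsub>W\<^esub>"
  by (auto simp: W_mult W_one)

lemma W_preserves_roots:
  assumes "w \<in> carrier W" "\<phi> \<in> \<Phi>"
  shows "w \<phi> \<in> \<Phi>"
proof -
  let ?S = "carrier (BijGroup UNIV) \<inter> reflection ` \<Delta>"
  have carrier: "carrier W = generate (BijGroup UNIV) ?S"
    by (simp add: weyl_group_def carrier_subgroup_generated)
  have "w \<in> generate (BijGroup UNIV) ?S" using assms carrier by simp
  then show ?thesis using assms(2)
  proof (induction arbitrary: \<phi>)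
    case one
    then show ?case by (simp add: BijGroup_def)
  next
    case (incl h)
    then show ?case by (auto intro: reflection_root simple_root_in_roots)
  next
    case (inv h)
    then obtain a where a: "a \<in> \<Delta>" "h = reflection a" by auto
    have "inv\<^bsub>BijGroup UNIV\<^esub> h = h"
      using group.inv_equality[OF group_BijGroup, where x = h and y = h] a(2)
      by (auto simp: BijGroup_def reflection_in_Bij compose_def)
    with a inv show ?case by (auto intro: reflection_root simple_root_in_roots)
  next
    case (eng h1 h2)
    then have "h1 \<otimes>\<^bsub>W\<^esub> h2 = h1 \<circ> h2"
      by (intro W_mult) (auto simp: carrier)
    with eng show ?case by (simp add: weyl_group_def)
  qed
qed

lemma root_permutation_action_hom:
  assumes "w \<in> carrier W"
  shows "root_permutation_action w \<in> hom (free_Abelian_group \<Phi>) (free_Abelian_group \<Phi>)"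
proof (rule homI)
  fix c assume "c \<in> carrier (free_Abelian_group \<Phi>)"
  then have "(\<Union>\<phi>\<in>Poly_Mapping.keys c. Poly_Mapping.keys (frag_of (w \<phi>))) \<subseteq> \<Phi>"
    using W_preserves_roots[OF assms] by auto
  then show "root_permutation_action w c \<in> carrier (free_Abelian_group \<Phi>)"
    unfolding root_permutation_action_def
    using keys_frag_extend[of "\<lambda>\<phi>. frag_of (w \<phi>)" c] by auto
qed (simp add: root_permutation_action_def frag_extend_add)

abbreviation S where "S \<equiv> roots_semidirect_weyl \<Phi> \<Delta>"

lemma group_S: "group S"
  unfolding roots_semidirect_weyl_def
proof (rule group_semidirect_product)
  fix c
  show "root_permutation_action \<one>\<^bsub>W\<^esub> c = c"
    by (simp add: root_permutation_action_def W_one flip: frag_expansion)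
next
  fix w w' c assume "w \<in> carrier W" "w' \<in> carrier W"
  then show "root_permutation_action (w \<otimes>\<^bsub>W\<^esub> w') c
      = root_permutation_action w (root_permutation_action w' c)"
    using frag_extend_compose[of "\<lambda>\<phi>. frag_of (w \<phi>)" w' c]
    by (simp add: root_permutation_action_def W_mult comp_def)
qed (simp_all add: root_permutation_action_hom)

lemma S_mult: "(v, w) \<otimes>\<^bsub>S\<^esub> (v', w') = (v + root_permutation_action w v', w \<otimes>\<^bsub>W\<^esub> w')"
  by (simp add: roots_semidirect_weyl_def semidirect_product_def)

lemma S_one: "\<one>\<^bsub>S\<^esub> = (0, \<one>\<^bsub>W\<^esub>)"
  by (simp add: roots_semidirect_weyl_def semidirect_product_def)

section \<open>The roots inverted by an alternating word\<close>

text \<open>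
  The roots \<open>inversion_root i a b\<close> for \<open>i < m\<close> are \<open>a, r\<^sub>a b, r\<^sub>a r\<^sub>b a, \<dots>\<close>: a prefix of \<open>i\<close> letters of the
  alternating word \<open>a b a \<dots>\<close> is applied to the letter that follows it. Peeling off the first letter,
  which swaps the two simple roots, fits the recursion of the alternating words. When \<open>m\<close> is at most
  the order of \<open>r\<^sub>a r\<^sub>b\<close>, they are the positive roots made negative by
  the inverse of the product of the word.
\<close>
fun inversion_root :: "nat \<Rightarrow> 'a \<Rightarrow> 'a \<Rightarrow> 'a" where
  "inversion_root 0 a b = a"
| "inversion_root (Suc n) a b = reflection a (inversion_root n b a)"

lemma inversion_root_in_roots: "a \<in> \<Delta> \<Longrightarrow> b \<in> \<Delta> \<Longrightarrow> inversion_root n a b \<in> \<Phi>"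
  by (induction n arbitrary: a b) (auto intro: reflection_root simple_root_in_roots)

lemma reflection_inversion_root:
  assumes "a \<in> \<Delta>" "b \<in> \<Delta>"
  shows "reflection (inversion_root n a b)
    = (reflection a \<otimes>\<^bsub>W\<^esub> reflection b) [^]\<^bsub>W\<^esub> n \<otimes>\<^bsub>W\<^esub> reflection a"
  using assms
proof (induction n arbitrary: a b)
  case (Suc n)
  let ?a = "reflection a" and ?b = "reflection b"
  have "reflection (inversion_root (Suc n) a b)
      = ?a \<circ> reflection (inversion_root n b a) \<circ> ?a"
    by (auto simp: reflection_reflection)
  also have "\<dots> = (?a \<otimes>\<^bsub>W\<^esub> ((?b \<otimes>\<^bsub>W\<^esub> ?a) [^]\<^bsub>W\<^esub> n \<otimes>\<^bsub>W\<^esub> ?b)) \<otimes>\<^bsub>W\<^esub> ?a"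
    using Suc by (subst Suc.IH) (auto simp: W_mult[symmetric])
  also have "\<dots> = (?a \<otimes>\<^bsub>W\<^esub> (?b \<otimes>\<^bsub>W\<^esub> ?a) [^]\<^bsub>W\<^esub> n) \<otimes>\<^bsub>W\<^esub> (?b \<otimes>\<^bsub>W\<^esub> ?a)"
    using Suc.prems by (simp add: W.m_assoc)
  also have "\<dots> = (?a \<otimes>\<^bsub>W\<^esub> ?b) [^]\<^bsub>W\<^esub> Suc n \<otimes>\<^bsub>W\<^esub> ?a"
    using Suc.prems by (simp add: W.nat_pow_mult_swap[symmetric] W.m_assoc)
  finally show ?case .
qed auto

text \<open>
  This is where the order of the product enters. A sign change at step \<open>n + 1\<close> can only occur if the
  root reached before is \<open>a\<close>; comparing reflections then gives \<open>(r\<^sub>b r\<^sub>a)\<^sup>n r\<^sub>b = r\<^sub>a\<close>, so the order of the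
  product of the two reflections divides \<open>n + 1\<close>.
\<close>
lemma inversion_root_nonneg:
  assumes "a \<in> \<Delta>" "b \<in> \<Delta>" and "n < W.ord (reflection a \<otimes>\<^bsub>W\<^esub> reflection b)"
  shows "nonneg_comb (inversion_root n a b)"
  using assms
proof (induction n arbitrary: a b)
  case 0
  then show ?case by (simp add: nonneg_comb_simple)
next
  case (Suc n)
  let ?a = "reflection a" and ?b = "reflection b"
  have ord: "W.ord (?b \<otimes>\<^bsub>W\<^esub> ?a) = W.ord (?a \<otimes>\<^bsub>W\<^esub> ?b)"
    using Suc.prems by (simp add: W.involution_products_ord)
  have "inversion_root n b a \<noteq> a"
  proof
    assume "inversion_root n b a = a"
    then have "(?b \<otimes>\<^bsub>W\<^esub> ?a) [^]\<^bsub>W\<^esub> n \<otimes>\<^bsub>W\<^esub> ?b = ?a"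
      using reflection_inversion_root[of b a n] Suc.prems by simp
    then have "((?b \<otimes>\<^bsub>W\<^esub> ?a) [^]\<^bsub>W\<^esub> n \<otimes>\<^bsub>W\<^esub> ?b) \<otimes>\<^bsub>W\<^esub> ?a = \<one>\<^bsub>W\<^esub>"
      using Suc.prems by simp
    then have "(?b \<otimes>\<^bsub>W\<^esub> ?a) [^]\<^bsub>W\<^esub> Suc n = \<one>\<^bsub>W\<^esub>"
      using Suc.prems by (simp add: W.m_assoc)
    then have "W.ord (?b \<otimes>\<^bsub>W\<^esub> ?a) dvd Suc n"
      using Suc.prems by (subst W.pow_eq_id[symmetric]) auto
    with ord Suc.prems(3) show False by (auto dest: dvd_imp_le)
  qed
  then show ?case
    using Suc.IH[of b a] Suc.prems ord
    by (auto intro: reflection_preserves_nonneg_comb inversion_root_in_roots)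
qed

text \<open>
  With \<open>m = i + j + 1\<close> the order of \<open>r\<^sub>a r\<^sub>b\<close>, the roots number \<open>i\<close> of the list beginning with \<open>a\<close> and
  number \<open>m - 1 - i\<close> of the list beginning with \<open>b\<close> are both positive and define the same reflection.
\<close>
lemma inversion_root_reverse:
  assumes ab: "a \<in> \<Delta>" "b \<in> \<Delta>"
    and ord: "W.ord (reflection a \<otimes>\<^bsub>W\<^esub> reflection b) = Suc (i + j)"
  shows "inversion_root i a b = inversion_root j b a"
proof (rule positive_root_determined_by_reflection)
  let ?a = "reflection a" and ?b = "reflection b"
  have "W.ord (?b \<otimes>\<^bsub>W\<^esub> ?a) = Suc (i + j)"
    using ab ord W.involution_products_ord[of ?a ?b] by simp
  then show "nonneg_comb (inversion_root i a b)" "nonneg_comb (inversion_root j b a)"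
    using ab ord by (auto intro: inversion_root_nonneg)
  have "(?a \<otimes>\<^bsub>W\<^esub> ?b) [^]\<^bsub>W\<^esub> Suc (i + j) = \<one>\<^bsub>W\<^esub>"
    using W.pow_ord_eq_1[of "?a \<otimes>\<^bsub>W\<^esub> ?b"] ab ord by (simp del: nat_pow_Suc)
  then show "reflection (inversion_root i a b) = reflection (inversion_root j b a)"
    using ab W.involution_conjugates_coincide[of ?a ?b i j]
    by (simp add: reflection_inversion_root del: nat_pow_Suc)
qed (use ab in \<open>auto intro: inversion_root_in_roots\<close>)

section \<open>The braid relations in the semidirect product\<close>

lemma braid_relations_W:
  "\<forall>(u, v)\<in>braid_relations \<Delta>. word_eval W reflection u = word_eval W reflection v"
proof clarify
  fix u v assume uv_rel: "(u, v) \<in> braid_relations \<Delta>"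
  obtain m a b where uv: "u = alternating_word m a b" "v = alternating_word m b a"
    and ab: "a \<in> \<Delta>" "b \<in> \<Delta>" and m: "m = W.ord (reflection a \<otimes>\<^bsub>W\<^esub> reflection b)"
    using uv_rel unfolding braid_relations_def by auto
  have "(reflection a \<otimes>\<^bsub>W\<^esub> reflection b) [^]\<^bsub>W\<^esub> m = \<one>\<^bsub>W\<^esub>"
    unfolding m using ab by (intro W.pow_ord_eq_1) simp
  moreover have "word_eval W reflection (alternating_word m b a) \<in> carrier W"
    using ab by (intro W.word_eval_closed[of _ \<Delta>]) auto
  ultimately show "word_eval W reflection u = word_eval W reflection v"
    unfolding uv using W.alternating_word_eval_swap[of reflection a b m] ab by simp
qed

text \<open>
  Each letter contributes its basis vector, moved by the Weyl group component of the letters before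
  it.
\<close>
lemma alternating_word_eval_S:
  "word_eval S (\<lambda>a. (frag_of a, reflection a)) (alternating_word m a b)
    = (\<Sum>i<m. frag_of (inversion_root i a b), word_eval W reflection (alternating_word m a b))"
proof (induction m arbitrary: a b)
  case (Suc m)
  have "root_permutation_action (reflection a) (\<Sum>i<m. frag_of (inversion_root i b a))
      = (\<Sum>i<m. frag_of (inversion_root (Suc i) a b))"
    by (simp add: root_permutation_action_def frag_extend_sum comp_def)
  with Suc show ?case
    by (simp add: S_mult sum.lessThan_Suc_shift del: sum.lessThan_Suc)
qed (simp add: S_one)

lemma braid_relations_S:
  "\<forall>(u, v)\<in>braid_relations \<Delta>. word_eval S (\<lambda>a. (frag_of a, reflection a)) u
    = word_eval S (\<lambda>a. (frag_of a, reflection a)) v"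
proof clarify
  fix u v assume uv_rel: "(u, v) \<in> braid_relations \<Delta>"
  obtain m a b where uv: "u = alternating_word m a b" "v = alternating_word m b a"
    and ab: "a \<in> \<Delta>" "b \<in> \<Delta>" and m: "m = W.ord (reflection a \<otimes>\<^bsub>W\<^esub> reflection b)"
    using uv_rel unfolding braid_relations_def by auto
  have "(\<Sum>i<m. frag_of (inversion_root i a b)) = (\<Sum>i<m. frag_of (inversion_root (m - Suc i) b a))"
  proof (rule sum.cong)
    fix i assume "i \<in> {..<m}"
    then show "frag_of (inversion_root i a b) = frag_of (inversion_root (m - Suc i) b a)"
      using inversion_root_reverse[OF ab, of i "m - Suc i"] m by simp
  qed simp
  also have "\<dots> = (\<Sum>i<m. frag_of (inversion_root i b a))"
    by (rule sum.nat_diff_reindex)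
  finally show "word_eval S (\<lambda>a. (frag_of a, reflection a)) u
      = word_eval S (\<lambda>a. (frag_of a, reflection a)) v"
    using braid_relations_W uv_rel by (auto simp: uv alternating_word_eval_S)
qed

lemma generator_images_in_S: "(\<lambda>a. (frag_of a, reflection a)) \<in> \<Delta> \<rightarrow> carrier S"
  using simple_root_in_roots
  by (auto simp: roots_semidirect_weyl_def semidirect_product_def)

lemma artin_to_weyl_gen: "a \<in> \<Delta> \<Longrightarrow> artin_to_weyl \<Delta> (artin_gen \<Delta> a) = reflection a"
  unfolding artin_to_weyl_def artin_gen_def
  by (rule W.presented_lift_gen[OF _ braid_relations_W]) auto

end

theorem theorem5p1:
  fixes \<Phi> \<Delta> :: "'a::euclidean_space set"
  assumes "root_system \<Phi>" and "simple_roots \<Phi> \<Delta>"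
  shows "\<exists>!f. f \<in> extensional (carrier (artin_group \<Delta>)) \<and>
    group_hom (artin_group \<Delta>) (roots_semidirect_weyl \<Phi> \<Delta>) f \<and>
    (\<forall>a\<in>\<Delta>. f (artin_gen \<Delta> a) = (frag_of a, artin_to_weyl \<Delta> (artin_gen \<Delta> a)))"
proof -
  interpret root_base \<Phi> \<Delta> using assms by unfold_locales
  interpret S: group "roots_semidirect_weyl \<Phi> \<Delta>" by (rule group_S)
  let ?A = "artin_group \<Delta>" and ?g = "\<lambda>a. (frag_of a, reflection a)"
  have A: "group ?A"
    by (simp add: artin_group_def group_presented_group)
  have gen: "artin_gen \<Delta> a \<in> carrier ?A" if "a \<in> \<Delta>" for a
    using that by (simp add: artin_gen_def artin_group_def presented_gen_def)
  define F where "F = restrict (presented_lift S ?g) (carrier ?A)"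
  have "presented_lift S ?g \<in> hom ?A S"
    unfolding artin_group_def
    by (rule S.presented_lift_hom[OF generator_images_in_S braid_relations_S])
  then have "F \<in> hom ?A S"
    using group.is_monoid[OF A] by (auto simp: F_def hom_def Pi_iff monoid.m_closed)
  then have F_hom: "group_hom ?A S F"
    using A group_S by (simp add: group_hom_def group_hom_axioms_def)
  have F_gen: "F (artin_gen \<Delta> a) = (frag_of a, artin_to_weyl \<Delta> (artin_gen \<Delta> a))"
    if "a \<in> \<Delta>" for a
    using that gen[OF that] S.presented_lift_gen[OF generator_images_in_S braid_relations_S that]
    by (simp add: F_def artin_to_weyl_gen) (simp add: artin_gen_def)
  show ?thesis
  proof (rule ex1I)
    show "F \<in> extensional (carrier ?A) \<and> group_hom ?A S F \<and>
        (\<forall>a\<in>\<Delta>. F (artin_gen \<Delta> a) = (frag_of a, artin_to_weyl \<Delta> (artin_gen \<Delta> a)))"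
      using F_hom F_gen by (simp add: F_def)
  next
    fix f assume f: "f \<in> extensional (carrier ?A) \<and> group_hom ?A S f \<and>
        (\<forall>a\<in>\<Delta>. f (artin_gen \<Delta> a) = (frag_of a, artin_to_weyl \<Delta> (artin_gen \<Delta> a)))"
    show "f = F"
    proof (rule extensionalityI)
      show "f \<in> extensional (carrier ?A)" "F \<in> extensional (carrier ?A)"
        using f by (simp_all add: F_def)
      fix x assume "x \<in> carrier ?A"
      then show "f x = F x"
        using presented_group_hom_unique[of \<Delta> "braid_relations \<Delta>" S f F x] f F_hom F_gen
        by (simp add: artin_group_def artin_gen_def)
    qed
  qed
qed

end
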